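(* Let $t\ge 3$, let $T_t$ be a tree on $t$ vertices and let $G$ be a $T_t$-free graph. Then $$\rho_{t-1}(G)\le\rho_{t-1}(K_{t-1})=1.$$ If $|V(G)|\ge t-1$, then equality $\rho_{t-1}(G)=\rho_{t-1}(K_{t-1})$ holds if and only if $K_{t-1}$ is a component of $G$ (i.e. some connected component of $G$ is isomorphic to $K_{t-1}$).
   Context: All graphs are finite, simple and undirected. $K_m$ is the complete graph on $m$ vertices. A graph $G$ is $F$-free if it contains no (not necessarily induced) subgraph isomorphic to $F$. A component is a maximal connected subgraph. For an integer $r\ge 2$, let $\mathcal C_r(G)$ be the family of $r$-cliques (copies of $K_r$) of $G$. For a graph $G$ with vertices indexed $1,\dots,n$, the $r$-clique tensor of $G$ is the order-$r$, dimension-$n$ symmetric tensor $\mathcal A_r(G)=(a_{i_1\ldots i_r})$ with $a_{i_1\ldots i_r}=\frac{1}{(r-1)!}$ if $\{i_1,\ldots,i_r\}\in\mathcal C_r(G)$ and $0$ otherwise. Its spectral radius is called the $r$-clique spectral radius $\rho_r(G)$. Equivalently (variational characterization), $$\rho_r(G)=\max\Big\{ r\sum_{\{i_1,\ldots,i_r\}\in\mathcal C_r(G)}x_{i_1}\cdots x_{i_r} : x_i\ge 0,\ \sum_{i=1}^n x_i^r=1\Big\}.$$ *)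

theory Defs
  imports Complex_Main "Graph_Theory.Graph_Theory"
begin

text \<open>
  Finite simple undirected graphs are the \<^locale>\<open>pair_graph\<close>s of the Graph_Theory library: a
  finite vertex set together with a symmetric irreflexive set of pairs, each undirected edge being
  represented by its two orientations. Subgraphs, isomorphism, connectedness and
  \<^const>\<open>complete_digraph\<close> are those of the library.
\<close>

definition complete_graph :: "nat \<Rightarrow> nat pair_pre_digraph" where
  "complete_graph m = \<lparr> pverts = {..<m}, parcs = {(u, v). u < m \<and> v < m \<and> u \<noteq> v} \<rparr>"

lemma complete_digraph_complete_graph: "complete_digraph m (with_proj (complete_graph m))"
  by (auto simp: complete_graph_def complete_digraph_pair_def)

definition subgraph_free :: "'a pair_pre_digraph \<Rightarrow> 'b pair_pre_digraph \<Rightarrow> bool" where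
  "subgraph_free F G \<longleftrightarrow> \<not> (\<exists>H. subgraph H (with_proj G) \<and> digraph_iso (with_proj F) H)"

definition components :: "'a pair_pre_digraph \<Rightarrow> ('a, 'a \<times> 'a) pre_digraph set" where
  "components G = {H. pre_digraph.max_subgraph (with_proj G) Digraph_Component.connected H}"

text \<open>
  The library's \<^const>\<open>Digraph_Component.tree\<close> is not suitable for undirected graphs: traversing an
  edge back and forth counts as a \<^const>\<open>pre_digraph.cycle\<close> of length 2. The cycles of an
  undirected simple graph are the directed cycles of length at least 3.
\<close>
definition undirected_tree :: "'a pair_pre_digraph \<Rightarrow> bool" where
  "undirected_tree T \<longleftrightarrow> pair_graph T \<and> Digraph_Component.connected (with_proj T) \<and>
     \<not> (\<exists>p. pre_digraph.cycle (with_proj T) p \<and> length p \<ge> 3)"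

definition cliques :: "nat \<Rightarrow> 'a pair_pre_digraph \<Rightarrow> 'a set set" where
  "cliques r G = {S. S \<subseteq> pverts G \<and> complete_digraph r (induce_subgraph (with_proj G) S)}"

text \<open>
  A tensor of order \<open>r\<close> with index set \<open>I\<close> (dimension \<open>card I\<close>) is a function on the lists of
  length \<open>r\<close> over \<open>I\<close>. Tensors of graphs are indexed by the vertices themselves rather than by an
  enumeration of them.

  Eigenvalues: \<open>\<theta>\<close> such that some nonzero complex vector \<open>x\<close> satisfies \<open>A x\<^sup>r\<^sup>-\<^sup>1 = \<theta> x\<^sup>[\<^sup>r\<^sup>-\<^sup>1\<^sup>]\<close>,
  where the right-hand power is taken componentwise.
\<close>
definition tensor_eigenvalue ::
    "'a set \<Rightarrow> nat \<Rightarrow> ('a list \<Rightarrow> complex) \<Rightarrow> complex \<Rightarrow> bool" where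
  "tensor_eigenvalue I r A \<theta> \<longleftrightarrow>
     (\<exists>x :: 'a \<Rightarrow> complex. (\<exists>i\<in>I. x i \<noteq> 0) \<and>
        (\<forall>i\<in>I. (\<Sum>js\<in>{js. set js \<subseteq> I \<and> length js = r - 1}. A (i # js) * (\<Prod>j\<leftarrow>js. x j))
                = \<theta> * x i ^ (r - 1)))"

text \<open>
  The largest modulus of an eigenvalue. The inserted \<open>0\<close> only matters for the empty index set, where
  there are no eigenvalues; it fixes the value there as \<open>0\<close>.
\<close>
definition tensor_spectral_radius :: "'a set \<Rightarrow> nat \<Rightarrow> ('a list \<Rightarrow> complex) \<Rightarrow> real" where
  "tensor_spectral_radius I r A = Sup (insert 0 {cmod \<theta> | \<theta>. tensor_eigenvalue I r A \<theta>})"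

text \<open>
  Since a member of \<^term>\<open>cliques r G\<close> has \<open>r\<close> elements, the indices of a nonzero entry are distinct.
\<close>
definition clique_tensor :: "nat \<Rightarrow> 'a pair_pre_digraph \<Rightarrow> 'a list \<Rightarrow> complex" where
  "clique_tensor r G ks =
     (if length ks = r \<and> set ks \<in> cliques r G then 1 / fact (r - 1) else 0)"

definition clique_spectral_radius :: "nat \<Rightarrow> 'a pair_pre_digraph \<Rightarrow> real" where
  "clique_spectral_radius r G = tensor_spectral_radius (pverts G) r (clique_tensor r G)"

end

theory Submission
  imports Defs "HOL-Combinatorics.Multiset_Permutations"
begin

text \<open>
  Write \<open>r = t - 1\<close>. The whole argument rests on one observation: in a \<open>T\<close>-free graph a clique on
  \<open>r\<close> vertices has no edge leaving it. Indeed, a tree on \<open>r + 1\<close> vertices has a leaf \<open>l\<close>, attached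
  to some \<open>q\<close>; if the clique \<open>S\<close> had an edge from \<open>v \<in> S\<close> to \<open>w \<notin> S\<close>, then sending \<open>l\<close> to \<open>w\<close>, \<open>q\<close>
  to \<open>v\<close> and the other vertices arbitrarily (but injectively) into \<open>S - {v}\<close> would embed \<open>T\<close>
  (\<open>tree_free_clique_adjacency_closed\<close>). The leaf is an end of a longest path (\<open>undirected_tree_has_leaf\<close>).

  Hence the \<open>r\<close>-cliques are pairwise disjoint, and they are exactly the components isomorphic to
  \<open>K\<^sub>r\<close> (\<open>closed_clique_component\<close>, \<open>complete_component_clique\<close>). The eigenvalue equations of the
  clique tensor therefore decouple: at a vertex \<open>i\<close> of a clique \<open>S\<close> the equation reads
  \<open>\<Prod>j\<in>S - {i}. x j = \<theta> * x i ^ (r - 1)\<close>, and at a vertex outside all cliques it reads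
  \<open>0 = \<theta> * x i ^ (r - 1)\<close> (\<open>clique_tensor_apply\<close>, \<open>clique_tensor_outside\<close>). Looking at a coordinate of largest modulus gives
  \<open>\<bar>\<theta>\<bar> \<le> 1\<close>, and \<open>\<theta> = 0\<close> if there is no clique, while the indicator vector of a clique is an
  eigenvector for \<open>1\<close>. So the spectral radius is \<open>1\<close> or \<open>0\<close> according to whether an \<open>r\<close>-clique
  exists (\<open>clique_spectral_radius_closed_cliques\<close>), which settles both the bound and the equality
  case; \<open>K\<^sub>r\<close> itself is covered by the same computation.
\<close>

section \<open>Cliques and embeddings\<close>

definition adjacency_closed :: "'a pair_pre_digraph \<Rightarrow> 'a set \<Rightarrow> bool" where
  "adjacency_closed G S \<longleftrightarrow> (\<forall>u v. (u, v) \<in> parcs G \<longrightarrow> u \<in> S \<longrightarrow> v \<in> S)"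

lemma in_cliques_iff:
  assumes "pair_graph G"
  shows "S \<in> cliques r G \<longleftrightarrow>
    S \<subseteq> pverts G \<and> card S = r \<and> (\<forall>u\<in>S. \<forall>v\<in>S. u \<noteq> v \<longrightarrow> (u, v) \<in> parcs G)"
proof -
  interpret pair_graph G by fact
  define H where "H = \<lparr>pverts = S, parcs = {e \<in> parcs G. fst e \<in> S \<and> snd e \<in> S}\<rparr>"
  have "induce_subgraph (with_proj G) S = with_proj H"
    by (simp add: induce_subgraph_def with_proj_def H_def)
  then have "S \<in> cliques r G \<longleftrightarrow> S \<subseteq> pverts G \<and> complete_digraph r (with_proj H)"
    by (simp add: cliques_def)
  moreover have "parcs H = {(u, v). (u, v) \<in> pverts H \<times> pverts H \<and> u \<noteq> v} \<longleftrightarrow>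
      (\<forall>u\<in>S. \<forall>v\<in>S. u \<noteq> v \<longrightarrow> (u, v) \<in> parcs G)"
    using no_loops' by (force simp: H_def)
  moreover have "finite S" if "S \<subseteq> pverts G"
    using that pair_finite_verts by (rule finite_subset)
  ultimately show ?thesis
    unfolding complete_digraph_pair_def by (auto simp: H_def)
qed

lemma pair_graph_complete_graph: "pair_graph (complete_graph m)"
  using complete_digraph_complete_graph pair_graphI_graph
  unfolding complete_digraph_def by blast

lemma cliques_complete_graph: "cliques m (complete_graph m) = {{..<m}}"
proof -
  have "S \<subseteq> {..<m} \<and> card S = m \<longleftrightarrow> S = {..<m}" for S :: "nat set"
    using card_subset_eq[of "{..<m}" S] by auto
  then show ?thesis
    unfolding set_eq_iff[of "cliques m _"] in_cliques_iff[OF pair_graph_complete_graph]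
    by (auto simp: complete_graph_def)
qed

text \<open>
  An isomorphism of the library also renames arcs and end maps; for graphs whose arcs are pairs, a
  vertex map \<open>f\<close> determines the rest.
\<close>
lemma with_proj_app_iso:
  "app_iso \<lparr>iso_verts = f, iso_arcs = map_prod f f, iso_head = snd, iso_tail = fst\<rparr> (with_proj F)
    = with_proj \<lparr>pverts = f ` pverts F, parcs = map_prod f f ` parcs F\<rparr>"
  by (simp add: app_iso_def with_proj_def)

lemma digraph_iso_image:
  assumes "pair_wf_digraph F" and inj: "inj_on f (pverts F)"
  shows "digraph_iso (with_proj F)
    (with_proj \<lparr>pverts = f ` pverts F, parcs = map_prod f f ` parcs F\<rparr>)"
proof -
  interpret pair_wf_digraph F by fact
  have "parcs F \<subseteq> pverts F \<times> pverts F"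
    by (auto dest: in_arcsD1 in_arcsD2)
  then have "inj_on (map_prod f f) (parcs F)"
    using map_prod_inj_on[OF inj inj] by (rule inj_on_subset[rotated])
  then have "digraph_isomorphism
      \<lparr>iso_verts = f, iso_arcs = map_prod f f, iso_head = snd, iso_tail = fst\<rparr>"
    using inj wf_digraph by (auto simp: digraph_isomorphism_def)
  then show ?thesis
    unfolding digraph_iso_def by (metis with_proj_app_iso)
qed

lemma not_subgraph_freeI:
  assumes F: "pair_wf_digraph F" and G: "pair_wf_digraph G"
    and inj: "inj_on f (pverts F)" and verts: "f ` pverts F \<subseteq> pverts G"
    and arcs: "\<And>u v. (u, v) \<in> parcs F \<Longrightarrow> (f u, f v) \<in> parcs G"
  shows "\<not> subgraph_free F G"
proof -
  let ?H = "\<lparr>pverts = f ` pverts F, parcs = map_prod f f ` parcs F\<rparr>"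
  interpret F: pair_wf_digraph F by fact
  have "pair_wf_digraph ?H"
    by unfold_locales (auto dest: F.in_arcsD1 F.in_arcsD2)
  then have "subgraph (with_proj ?H) (with_proj G)"
    using G verts arcs by (intro subgraphI) (auto simp: wf_digraph_wp_iff)
  then show ?thesis
    using digraph_iso_image[OF F inj] unfolding subgraph_free_def by blast
qed

section \<open>Leaves of trees\<close>

text \<open>
  Take a longest path, starting at \<open>u\<close>. All neighbours of \<open>u\<close> lie on it, since otherwise it could be
  prolonged. The next vertex \<open>w\<close> on the path is one of them; another one \<open>z\<close> would close the initial
  segment from \<open>u\<close> to \<open>z\<close>, which has at least two edges, to a cycle of length at least three.
\<close>
lemma undirected_tree_has_leaf:
  assumes T: "undirected_tree T" and card: "card (pverts T) \<ge> 2"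
  obtains l q where "(l, q) \<in> parcs T" and "\<And>z. (l, z) \<in> parcs T \<Longrightarrow> z = q"
proof -
  interpret pair_graph T using T by (simp add: undirected_tree_def)
  have "pverts T \<noteq> {}" using card by auto
  then obtain a where a: "a \<in> pverts T" by blast
  define P where "P = (\<lambda>n. \<exists>u p v. apath u p v \<and> length p = n)"
  have "apath a [] a" using a by (simp add: apath_Nil_iff)
  then have "P 0" unfolding P_def by fastforce
  have bounded: "n \<le> card (pverts T)" if "P n" for n
    using that unfolding P_def by (auto intro: length_apath)
  \<comment> \<open>paths have bounded length, so there is a longest one\<close>
  define n where "n = (GREATEST n. P n)"
  have "P n"
    unfolding n_def using \<open>P 0\<close> bounded by (rule GreatestI_nat)
  have n: "k \<le> n" if "P k" for k
    unfolding n_def using that bounded by (rule Greatest_le_nat)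
  obtain u p v where path: "apath u p v" and "length p = n"
    using \<open>P n\<close> unfolding P_def by blast
  then have longest: "length p' \<le> length p" if "apath u' p' v'" for u' p' v'
    using n[of "length p'"] that unfolding P_def by blast
  have u: "u \<in> pverts T" using path by (auto simp: apath_def)
  have on_path: "z \<in> set (awalk_verts u p)" if "(u, z) \<in> parcs T" for z
  proof (rule ccontr)
    assume "z \<notin> set (awalk_verts u p)"
    then have "apath z ((z, u) # p) v"
      using path that arcs_symmetric by (simp add: apath_Cons_iff)
    then show False using longest by fastforce
  qed
  \<comment> \<open>connectedness provides \<open>u\<close> with a neighbour\<close>
  have "\<not> pverts T \<subseteq> {u}"
    using card card_mono[of "{u}" "pverts T"] by auto
  then obtain b where b: "b \<in> pverts T" "b \<noteq> u" by blast
  have "parcs (mk_symmetric (with_proj T)) = parcs T"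
    using adj_mk_symmetric_eq[OF sym_arcs] by simp
  then have "(u, b) \<in> rtrancl_on (pverts T) (parcs T)"
    using T u b by (simp add: undirected_tree_def Digraph_Component.connected_def
        strongly_connected_def reachable_def)
  then obtain c where c: "(u, c) \<in> parcs T"
    using b by (cases rule: converse_rtrancl_on_cases) auto
  have "p \<noteq> []"
    using on_path[OF c] no_loops'[OF c] by auto
  then obtain w p' where p: "p = (u, w) # p'"
    using path by (cases p) (auto simp: apath_Cons_iff)
  have "z = w" if z: "(u, z) \<in> parcs T" for z
  proof (rule ccontr)
    assume zw: "z \<noteq> w"
    obtain q s where qs: "p = q @ s" and q: "awalk u q z"
      using awalk_decomp[of u p v z] path on_path[OF z] by (auto simp: apath_def)
    have "apath u q z"
      using path q unfolding qs by (auto simp: apath_append_iff)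
    then have dist: "distinct (awalk_verts u q)" by (simp add: apath_def)
    have zu: "(z, u) \<in> parcs T" using z by (rule arcs_symmetric)
    have "q \<noteq> []" using q no_loops'[OF z] by (auto simp: awalk_Nil_iff)
    then obtain q' where q': "q = (u, w) # q'"
      using qs p by (cases q) auto
    have "q' \<noteq> []" using q zw unfolding q' by (auto simp: awalk_simps)
    have walk: "awalk u (q @ [(z, u)]) u"
      using q zu u by (auto simp: awalk_simps)
    have "awalk_verts u (q @ [(z, u)]) = awalk_verts u q @ [u]"
      using awalk_verts_append[OF walk] by simp
    then have "tl (awalk_verts u (q @ [(z, u)])) = awalk_verts w q' @ [u]"
      by (simp add: q')
    moreover have "distinct (awalk_verts w q' @ [u])"
      using dist by (simp add: q')
    ultimately have "cycle (q @ [(z, u)])"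
      using walk unfolding cycle_def by (metis snoc_eq_iff_butlast)
    moreover have "length (q @ [(z, u)]) \<ge> 3"
      using q' \<open>q' \<noteq> []\<close> by (cases q') auto
    ultimately show False using T unfolding undirected_tree_def by blast
  qed
  moreover have "(u, w) \<in> parcs T"
    using path p by (simp add: apath_Cons_iff)
  ultimately show thesis using that by blast
qed

text \<open>
  A clique with a pendant edge contains every tree that has one vertex more than the clique: the
  pendant vertex hosts a leaf, and inside the clique all adjacencies are available.
\<close>
lemma tree_free_clique_adjacency_closed:
  assumes T: "undirected_tree T" and card: "card (pverts T) = Suc r" and r: "r \<ge> 1"
    and G: "pair_graph G" and free: "subgraph_free T G" and S: "S \<in> cliques r G"
  shows "adjacency_closed G S"
proof (rule ccontr)
  assume "\<not> adjacency_closed G S"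
  then obtain v w where vw: "(v, w) \<in> parcs G" "v \<in> S" "w \<notin> S"
    unfolding adjacency_closed_def by blast
  interpret T: pair_graph T using T by (simp add: undirected_tree_def)
  interpret G: pair_graph G by fact
  have SG: "S \<subseteq> pverts G" "card S = r"
    and adj: "\<And>a b. a \<in> S \<Longrightarrow> b \<in> S \<Longrightarrow> a \<noteq> b \<Longrightarrow> (a, b) \<in> parcs G"
    using S by (auto simp: in_cliques_iff[OF G])
  have finS: "finite S" using SG r by (metis card.infinite not_one_le_zero)
  obtain l q where lq: "(l, q) \<in> parcs T" and leaf: "\<And>z. (l, z) \<in> parcs T \<Longrightarrow> z = q"
    using undirected_tree_has_leaf[OF T] card r by auto
  have lq': "l \<in> pverts T" "q \<in> pverts T" "l \<noteq> q"
    using lq by (auto dest: T.in_arcsD1 T.in_arcsD2 T.no_loops')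
  have "card (pverts T - {l, q}) = card (S - {v})"
    using card lq' SG vw finS by (simp add: card_Diff_subset)
  then obtain g where g: "bij_betw g (pverts T - {l, q}) (S - {v})"
    using finite_same_card_bij finS T.pair_finite_verts by (metis finite_Diff)
  define f where "f = g(l := w, q := v)"
  have fl: "f l = w" and fq: "f q = v" and fg: "\<And>x. x \<noteq> l \<Longrightarrow> x \<noteq> q \<Longrightarrow> f x = g x"
    using lq' by (auto simp: f_def)
  have gS: "g x \<in> S - {v}" if "x \<in> pverts T" "x \<noteq> l" "x \<noteq> q" for x
    using bij_betwE[OF g] that by blast
  have fS: "f x \<in> S" if "x \<in> pverts T" "x \<noteq> l" for x
    using gS[OF that] that vw fq fg by (cases "x = q") auto
  have inj: "inj_on f (pverts T)"
  proof (rule inj_onI)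
    fix x y assume xy: "x \<in> pverts T" "y \<in> pverts T" "f x = f y"
    have "x = y" if "x \<noteq> l" "y \<noteq> l" "x \<noteq> q" "y \<noteq> q"
      using g xy that fg by (auto simp: bij_betw_def dest: inj_onD)
    moreover have "x = l \<longleftrightarrow> y = l"
      using xy fS[of x] fS[of y] vw(3) fl by (cases "x = l"; cases "y = l") auto
    moreover have "x = q \<longleftrightarrow> y = q" if "x \<noteq> l" "y \<noteq> l"
      using xy gS[of x] gS[of y] that fq fg by (metis Diff_iff singletonI)
    ultimately show "x = y" by blast
  qed
  have "f ` pverts T \<subseteq> pverts G"
    using fS fl SG vw G.in_arcsD2 by blast
  moreover have "(f x, f y) \<in> parcs G" if xy: "(x, y) \<in> parcs T" for x y
  proof -
    have xyT: "x \<in> pverts T" "y \<in> pverts T" "x \<noteq> y"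
      using xy by (auto dest: T.in_arcsD1 T.in_arcsD2 T.no_loops')
    consider "x = l" | "y = l" | "x \<noteq> l" "y \<noteq> l" by blast
    then show ?thesis
    proof cases
      case 1
      then show ?thesis using leaf xy fl fq vw G.arcs_symmetric by auto
    next
      case 2
      then show ?thesis using leaf[of x] T.arcs_symmetric[OF xy] fl fq vw by auto
    next
      case 3
      then show ?thesis using adj fS xyT inj by (auto dest: inj_onD)
    qed
  qed
  ultimately have "\<not> subgraph_free T G"
    using inj by (intro not_subgraph_freeI) (unfold_locales)
  then show False using free by blast
qed

section \<open>Closed cliques as components\<close>

lemma complete_component_clique:
  assumes G: "pair_graph G" and H: "H \<in> components G"
    and iso: "digraph_iso (with_proj (complete_graph r)) H"
  shows "verts H \<in> cliques r G"
proof -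
  let ?K = "with_proj (complete_graph r)"
  interpret K: pair_graph "complete_graph r" by (rule pair_graph_complete_graph)
  have sub: "subgraph H (with_proj G)"
    using H by (simp add: components_def pre_digraph.max_subgraph_def)
  obtain h where h: "pre_digraph.digraph_isomorphism ?K h" and H_eq: "H = app_iso h ?K"
    using iso unfolding digraph_iso_def by blast
  have "card (verts H) = r"
    using card_image[OF pre_digraph.digraph_isomorphism_inj_on_verts[OF h]] H_eq
    by (simp add: complete_graph_def)
  moreover have "(u, v) \<in> parcs G" if uv: "u \<in> verts H" "v \<in> verts H" "u \<noteq> v" for u v
  proof -
    have "arcs_ends H = (\<lambda>(a, b). (iso_verts h a, iso_verts h b)) ` parcs (complete_graph r)"
      using wf_digraph.arcs_ends_app_iso_eq[OF K.wf_digraph h] H_eq by simp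
    then have "(u, v) \<in> arcs_ends H"
      using uv by (auto simp: H_eq complete_graph_def)
    then show ?thesis using arcs_ends_mono[OF sub] by auto
  qed
  ultimately show ?thesis
    using sub by (auto simp: in_cliques_iff[OF G] subgraph_def)
qed

text \<open>
  The clique \<open>S\<close> spans a connected subgraph \<open>H\<close>. It is maximal because a walk starting in \<open>S\<close> cannot
  leave it, so a larger connected subgraph has no further vertices, and no further edges either as
  all pairs of vertices of \<open>S\<close> are already joined in \<open>H\<close>.
\<close>
lemma closed_clique_component:
  assumes G: "pair_graph G" and S: "S \<in> cliques r G" and r: "r \<ge> 1"
    and closed: "adjacency_closed G S"
  shows "\<exists>H \<in> components G. digraph_iso (with_proj (complete_graph r)) H"
proof -
  interpret G: pair_graph G by fact
  have SG: "S \<subseteq> pverts G" "card S = r"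
    and adj: "\<And>a b. a \<in> S \<Longrightarrow> b \<in> S \<Longrightarrow> a \<noteq> b \<Longrightarrow> (a, b) \<in> parcs G"
    using S by (auto simp: in_cliques_iff[OF G])
  have finS: "finite S" using SG r by (metis card.infinite not_one_le_zero)
  define H where "H = \<lparr>pverts = S, parcs = {(u, v). u \<in> S \<and> v \<in> S \<and> u \<noteq> v}\<rparr>"
  interpret H: pair_wf_digraph H by unfold_locales (auto simp: H_def)
  have wfG: "wf_digraph (with_proj G)" and wfH: "wf_digraph (with_proj H)"
    by unfold_locales
  have sub: "subgraph (with_proj H) (with_proj G)"
    using SG adj wfG wfH by (auto intro!: subgraphI simp: H_def)
  have conn: "Digraph_Component.connected (with_proj H)"
  proof (rule H.connectedI)
    show "pverts H \<noteq> {}" using SG r by (auto simp: H_def)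
    fix u v assume "u \<in> pverts H" "v \<in> pverts H"
    then have "(u, v) \<in> parcs H \<or> u = v \<and> v \<in> pverts H"
      by (auto simp: H_def)
    then have "u \<rightarrow>\<^sup>*\<^bsub>with_proj H\<^esub> v"
      using H.reachable_adjI H.reachable_refl by blast
    then show "u \<rightarrow>\<^sup>*\<^bsub>with_proj (mk_symmetric (with_proj H))\<^esub> v"
      by (rule H.reachable_mk_symmetricI)
  qed
  have max: "H' = with_proj H"
    if H': "subgraph (with_proj H) H'" "subgraph H' (with_proj G)"
      "Digraph_Component.connected H'" for H'
  proof -
    have proj: "tail H' = fst" "head H' = snd"
      using H'(2) by (auto simp: subgraph_def compatible_def)
    have arcs: "arcs H' \<subseteq> parcs G" and SH': "S \<subseteq> verts H'"
      using H' by (auto simp: subgraph_def H_def)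
    have sym: "parcs (mk_symmetric H') \<subseteq> parcs G"
      using arcs G.arcs_symmetric by (auto simp: parcs_mk_symmetric proj)
    obtain s where s: "s \<in> S" using SG r by fastforce
    have "v \<in> S" if v: "v \<in> verts H'" for v
    proof -
      have "(s, v) \<in> rtrancl_on (verts H') (parcs (mk_symmetric H'))"
        using H'(3) s v SH' by (auto simp: Digraph_Component.connected_def
            strongly_connected_def reachable_def)
      then show ?thesis
        using s by induct (use sym closed in \<open>auto simp: adjacency_closed_def\<close>)
    qed
    then have verts: "verts H' = S" using SH' by blast
    interpret H': wf_digraph H' using H'(2) by (simp add: subgraph_def)
    have "arcs H' \<subseteq> parcs H"
      using arcs H'.tail_in_verts H'.head_in_verts G.no_loops'
      by (fastforce simp: H_def verts proj)
    then have "arcs H' = parcs H" using H'(1) by (auto simp: subgraph_def)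
    then show ?thesis
      using verts proj by (intro pre_digraph.equality) (auto simp: H_def)
  qed
  have "with_proj H \<in> components G"
    using sub conn max unfolding components_def pre_digraph.max_subgraph_def by blast
  moreover have "digraph_iso (with_proj (complete_graph r)) (with_proj H)"
  proof -
    interpret K: pair_graph "complete_graph r" by (rule pair_graph_complete_graph)
    obtain f where f: "bij_betw f {..<r} S"
      using finite_same_card_bij[of "{..<r}" S] finS SG by auto
    then have inj: "inj_on f {..<r}" and img: "f ` {..<r} = S"
      by (auto simp: bij_betw_def)
    have "map_prod f f ` {(u, v). u < r \<and> v < r \<and> u \<noteq> v} = {(u, v). u \<in> S \<and> v \<in> S \<and> u \<noteq> v}"
      unfolding img[symmetric] using inj by (fastforce simp: image_iff dest: inj_onD)
    then have "H = \<lparr>pverts = f ` pverts (complete_graph r),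
        parcs = map_prod f f ` parcs (complete_graph r)\<rparr>"
      using img by (simp add: H_def complete_graph_def)
    then show ?thesis
      using digraph_iso_image[of "complete_graph r" f] inj K.pair_wf_digraph
      by (simp add: complete_graph_def)
  qed
  ultimately show ?thesis by blast
qed

section \<open>The clique tensor of a graph with closed cliques\<close>

text \<open>
  A vertex lies in at most one closed clique \<open>S\<close>, so the nonzero entries \<open>i # js\<close> are the \<open>(r - 1)!\<close>
  orderings \<open>js\<close> of \<open>S - {i}\<close>. They all contribute the same product, and the normalisation
  \<open>1 / (r - 1)!\<close> of the tensor cancels their number.
\<close>
lemma clique_tensor_apply:
  assumes G: "pair_graph G" and closed: "\<forall>S\<in>cliques r G. adjacency_closed G S"
    and S: "S \<in> cliques r G" and i: "i \<in> S"
  shows "(\<Sum>js\<in>{js. set js \<subseteq> pverts G \<and> length js = r - 1}.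
      clique_tensor r G (i # js) * (\<Prod>j\<leftarrow>js. x j)) = (\<Prod>j\<in>S - {i}. x j)"
proof -
  interpret G: pair_graph G by fact
  let ?L = "{js. set js \<subseteq> pverts G \<and> length js = r - 1}"
  let ?P = "permutations_of_set (S - {i})"
  have SG: "S \<subseteq> pverts G" "card S = r" using S by (auto simp: in_cliques_iff[OF G])
  have finS: "finite S" using SG(1) G.pair_finite_verts by (rule finite_subset)
  have r: "r > 0" using i finS SG by (metis card_gt_0_iff empty_iff)
  have cardSi: "card (S - {i}) = r - 1" using i finS SG by simp
  have subset: "?P \<subseteq> ?L"
    using SG(1) cardSi length_finite_permutations_of_set
    by (fastforce simp: permutations_of_set_def)
  have entry: "clique_tensor r G (i # js) * (\<Prod>j\<leftarrow>js. x j) = (\<Prod>j\<in>S - {i}. x j) / fact (r - 1)"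
    if js: "js \<in> ?P" for js
  proof -
    have "length (i # js) = r"
      using length_finite_permutations_of_set[OF js] cardSi r by simp
    moreover have "set (i # js) \<in> cliques r G"
      using S i permutations_of_setD(1)[OF js] by (simp add: insert_absorb)
    moreover have "(\<Prod>j\<leftarrow>js. x j) = (\<Prod>j\<in>S - {i}. x j)"
      using permutations_of_setD[OF js] prod.distinct_set_conv_list by metis
    ultimately show ?thesis by (simp add: clique_tensor_def)
  qed
  have zero: "clique_tensor r G (i # js) = 0" if js: "js \<in> ?L - ?P" for js
  proof (rule ccontr)
    assume "clique_tensor r G (i # js) \<noteq> 0"
    then have len: "length (i # js) = r" and C: "set (i # js) \<in> cliques r G"
      by (auto simp: clique_tensor_def split: if_splits)
    \<comment> \<open>a clique through \<open>i\<close> cannot leave the closed clique \<open>S\<close>, so it is \<open>S\<close>\<close>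
    have "set (i # js) \<subseteq> S"
    proof
      fix j assume "j \<in> set (i # js)"
      then have "j = i \<or> (i, j) \<in> parcs G" using C by (auto simp: in_cliques_iff[OF G])
      then show "j \<in> S" using i closed S by (auto simp: adjacency_closed_def)
    qed
    moreover have card: "card (set (i # js)) = r" using C by (simp add: in_cliques_iff[OF G])
    ultimately have "set (i # js) = S"
      using finS SG(2) by (intro card_subset_eq) auto
    moreover have "distinct (i # js)"
      using card len by (intro card_distinct) simp
    ultimately have "js \<in> ?P" by (auto simp: permutations_of_set_def)
    then show False using js by blast
  qed
  have "(\<Sum>js\<in>?L. clique_tensor r G (i # js) * (\<Prod>j\<leftarrow>js. x j))
      = (\<Sum>js\<in>?P. clique_tensor r G (i # js) * (\<Prod>j\<leftarrow>js. x j))"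
    using subset zero finite_lists_length_eq[OF G.pair_finite_verts]
    by (intro sum.mono_neutral_right) auto
  also have "\<dots> = (\<Sum>js\<in>?P. (\<Prod>j\<in>S - {i}. x j) / fact (r - 1))"
    using entry by (rule sum.cong[OF refl])
  also have "\<dots> = (\<Prod>j\<in>S - {i}. x j)"
    using finS cardSi by simp
  finally show ?thesis .
qed

lemma clique_tensor_outside:
  assumes "\<And>S. S \<in> cliques r G \<Longrightarrow> i \<notin> S"
  shows "clique_tensor r G (i # js) = 0"
  using assms[of "set (i # js)"] by (auto simp: clique_tensor_def)

text \<open>
  Let \<open>x i\<close> be a coordinate of largest modulus. If \<open>i\<close> lies in a clique, its equation equates
  \<open>\<theta> * x i ^ (r - 1)\<close> with a product of \<open>r - 1\<close> coordinates, none of larger modulus than \<open>x i\<close>;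
  otherwise it forces \<open>\<theta> = 0\<close>.
\<close>
lemma clique_tensor_eigenvalue_le:
  assumes G: "pair_graph G" and closed: "\<forall>S\<in>cliques r G. adjacency_closed G S"
    and ev: "tensor_eigenvalue (pverts G) r (clique_tensor r G) \<theta>"
  shows "cmod \<theta> \<le> (if cliques r G = {} then 0 else 1)"
proof -
  interpret G: pair_graph G by fact
  obtain x where nz: "\<exists>i\<in>pverts G. x i \<noteq> 0" and eq: "\<And>i. i \<in> pverts G \<Longrightarrow>
      (\<Sum>js\<in>{js. set js \<subseteq> pverts G \<and> length js = r - 1}.
        clique_tensor r G (i # js) * (\<Prod>j\<leftarrow>js. x j)) = \<theta> * x i ^ (r - 1)"
    using ev unfolding tensor_eigenvalue_def by blast
  have fin: "finite (pverts G)" and ne: "pverts G \<noteq> {}"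
    using nz G.pair_finite_verts by auto
  define i where "i = arg_min_on (\<lambda>j. - cmod (x j)) (pverts G)"
  have i: "i \<in> pverts G"
    unfolding i_def using fin ne by (rule arg_min_if_finite(1))
  have max: "cmod (x j) \<le> cmod (x i)" if "j \<in> pverts G" for j
    using arg_min_least[OF fin ne that, of "\<lambda>j. - cmod (x j)"] by (simp add: i_def)
  have pos: "cmod (x i) ^ (r - 1) > 0"
  proof -
    obtain k where k: "k \<in> pverts G" "x k \<noteq> 0" using nz by blast
    have "0 < cmod (x k)" using k(2) by simp
    also have "\<dots> \<le> cmod (x i)" using k(1) by (rule max)
    finally show ?thesis by simp
  qed
  show ?thesis
  proof (cases "\<exists>S\<in>cliques r G. i \<in> S")
    case True
    then obtain S where S: "S \<in> cliques r G" "i \<in> S" by blast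
    have SG: "S \<subseteq> pverts G" "card S = r" using S by (auto simp: in_cliques_iff[OF G])
    have finS: "finite S" using SG(1) G.pair_finite_verts by (rule finite_subset)
    have "\<theta> * x i ^ (r - 1) = (\<Prod>j\<in>S - {i}. x j)"
      using eq[OF i] clique_tensor_apply[OF G closed S] by simp
    then have "cmod \<theta> * cmod (x i) ^ (r - 1) = (\<Prod>j\<in>S - {i}. cmod (x j))"
      by (metis norm_mult norm_power prod_norm)
    also have "\<dots> \<le> (\<Prod>j\<in>S - {i}. cmod (x i))"
      using max SG(1) by (intro prod_mono) auto
    also have "\<dots> = cmod (x i) ^ (r - 1)"
      using S(2) SG(2) finS by simp
    finally show ?thesis using pos S by auto
  next
    case False
    then have "\<theta> * x i ^ (r - 1) = 0"
      using eq[OF i] clique_tensor_outside[of r G i] by simp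
    moreover have "x i ^ (r - 1) \<noteq> 0"
      using pos by (metis norm_power norm_zero less_irrefl)
    ultimately have "\<theta> = 0" by (metis mult_eq_0_iff)
    then show ?thesis by simp
  qed
qed

text \<open>
  The eigenvector is the indicator of \<open>S\<close>. It is constant on every clique \<open>C\<close>, because closedness of
  \<open>S\<close> leaves only \<open>C \<subseteq> S\<close> or \<open>C \<inter> S = {}\<close>; so at a vertex \<open>i\<close> of \<open>C\<close> the clique product is
  \<open>x i ^ (r - 1)\<close>. At a vertex outside all cliques both sides vanish, the right-hand one because
  \<open>r - 1 > 0\<close>.
\<close>
lemma clique_tensor_eigenvalue_one:
  assumes G: "pair_graph G" and closed: "\<forall>S\<in>cliques r G. adjacency_closed G S"
    and S: "S \<in> cliques r G" and r: "r \<ge> 2"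
  shows "tensor_eigenvalue (pverts G) r (clique_tensor r G) 1"
proof -
  interpret G: pair_graph G by fact
  define x :: "'a \<Rightarrow> complex" where "x i = (if i \<in> S then 1 else 0)" for i
  have SG: "S \<subseteq> pverts G" "card S = r" using S by (auto simp: in_cliques_iff[OF G])
  have "S \<noteq> {}" using SG(2) r by auto
  then have "\<exists>i\<in>pverts G. x i \<noteq> 0" using SG(1) by (auto simp: x_def)
  moreover have "(\<Sum>js\<in>{js. set js \<subseteq> pverts G \<and> length js = r - 1}.
      clique_tensor r G (i # js) * (\<Prod>j\<leftarrow>js. x j)) = 1 * x i ^ (r - 1)" if "i \<in> pverts G" for i
  proof (cases "\<exists>C\<in>cliques r G. i \<in> C")
    case True
    then obtain C where C: "C \<in> cliques r G" "i \<in> C" by blast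
    have CG: "C \<subseteq> pverts G" "card C = r"
      and adj: "\<And>j. j \<in> C \<Longrightarrow> j \<noteq> i \<Longrightarrow> (i, j) \<in> parcs G \<and> (j, i) \<in> parcs G"
      using C by (auto simp: in_cliques_iff[OF G])
    have finC: "finite C" using CG(1) G.pair_finite_verts by (rule finite_subset)
    have iff: "j \<in> S \<longleftrightarrow> i \<in> S" if "j \<in> C" for j
      using adj[OF that] closed S unfolding adjacency_closed_def by metis
    have "(\<Prod>j\<in>C - {i}. x j) = (\<Prod>j\<in>C - {i}. x i)"
      using iff by (intro prod.cong) (auto simp: x_def)
    also have "\<dots> = x i ^ (r - 1)" using C(2) CG(2) finC by simp
    finally show ?thesis using clique_tensor_apply[OF G closed C] by simp
  next
    case False
    then have "i \<notin> S" using S by blast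
    then show ?thesis
      using False clique_tensor_outside[of r G i] r by (simp add: x_def)
  qed
  ultimately show ?thesis unfolding tensor_eigenvalue_def by blast
qed

lemma clique_spectral_radius_closed_cliques:
  assumes G: "pair_graph G" and closed: "\<forall>S\<in>cliques r G. adjacency_closed G S"
    and r: "r \<ge> 2"
  shows "clique_spectral_radius r G = (if cliques r G = {} then 0 else 1)"
proof -
  let ?E = "insert 0 {cmod \<theta> | \<theta>. tensor_eigenvalue (pverts G) r (clique_tensor r G) \<theta>}"
  let ?m = "if cliques r G = {} then 0 else 1 :: real"
  have "?m \<in> ?E"
    using clique_tensor_eigenvalue_one[OF G closed _ r] by (auto intro!: exI[of _ 1])
  moreover have "e \<le> ?m" if e: "e \<in> ?E" for e
  proof -
    from e consider "e = 0"
      | \<theta> where "e = cmod \<theta>" "tensor_eigenvalue (pverts G) r (clique_tensor r G) \<theta>"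
      by blast
    then show ?thesis
      by cases (simp_all add: clique_tensor_eigenvalue_le[OF G closed])
  qed
  ultimately have "Sup ?E = ?m" by (rule cSup_eq_maximum)
  then show ?thesis unfolding clique_spectral_radius_def tensor_spectral_radius_def .
qed

section \<open>The spectral bound\<close>

theorem theorem1p8:
  fixes t :: nat and T :: "'a pair_pre_digraph" and G :: "'b pair_pre_digraph"
  assumes "t \<ge> 3"
    and "undirected_tree T" and "card (pverts T) = t"
    and "pair_graph G" and "subgraph_free T G"
  shows "clique_spectral_radius (t - 1) G \<le> clique_spectral_radius (t - 1) (complete_graph (t - 1)) \<and>
    clique_spectral_radius (t - 1) (complete_graph (t - 1)) = 1 \<and>
    (card (pverts G) \<ge> t - 1 \<longrightarrow>
      (clique_spectral_radius (t - 1) G = clique_spectral_radius (t - 1) (complete_graph (t - 1)) \<longleftrightarrow>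
       (\<exists>H \<in> components G. digraph_iso (with_proj (complete_graph (t - 1))) H)))"
proof -
  let ?r = "t - 1"
  have r: "?r \<ge> 2" and card: "card (pverts T) = Suc ?r"
    using assms(1,3) by auto
  have closed: "\<forall>S\<in>cliques ?r G. adjacency_closed G S"
    using tree_free_clique_adjacency_closed[OF assms(2) card _ assms(4,5)] r by simp
  have "\<forall>S\<in>cliques ?r (complete_graph ?r). adjacency_closed (complete_graph ?r) S"
    by (simp add: cliques_complete_graph adjacency_closed_def) (simp add: complete_graph_def)
  then have K: "clique_spectral_radius ?r (complete_graph ?r) = 1"
    using clique_spectral_radius_closed_cliques[OF pair_graph_complete_graph _ r]
    by (simp add: cliques_complete_graph)
  have "cliques ?r G \<noteq> {} \<longleftrightarrow>
      (\<exists>H \<in> components G. digraph_iso (with_proj (complete_graph ?r)) H)"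
    using closed_clique_component[OF assms(4), of _ ?r] closed
      complete_component_clique[OF assms(4), of _ ?r] r by fastforce
  moreover have "clique_spectral_radius ?r G = (if cliques ?r G = {} then 0 else 1)"
    using assms(4) closed r by (rule clique_spectral_radius_closed_cliques)
  ultimately show ?thesis
    unfolding K by (cases "cliques ?r G = {}") auto
qed

end
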